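(* (i) For all $e\geq 0$ and all $n$ with $0\leq n\leq 2^e$, $$s(2^e+n)=s(2^e-n)+s(n),\qquad t(2^e+n)=(-1)^e\bigl(s(2^e-n)-s(n)\bigr).$$ (ii) For all $e\geq 0$ and all $n$ with $0\leq n\leq 2^{e+1}$, $$t(3\cdot 2^e+n)=t(6\cdot 2^e-n)=(-1)^e s(n).$$
   Context: The Stern sequence $s$ is defined by $s(0)=0$, $s(1)=1$, $s(2n)=s(n)$, $s(2n+1)=s(n)+s(n+1)$ for $n\geq1$. The twisted Stern sequence $t$ is defined by $t(0)=0$, $t(1)=1$, $t(2n)=-t(n)$, $t(2n+1)=-t(n)-t(n+1)$ for $n\geq 1$. *)

theory Defs
  imports Main
begin

text \<open>The values are integers, so that the sign changes and differences below are not truncated.\<close>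

function stern :: "nat \<Rightarrow> int" where
  "stern n =
     (if n = 0 then 0
      else if n = 1 then 1
      else if even n then stern (n div 2)
      else stern (n div 2) + stern (n div 2 + 1))"
  by pat_completeness auto
termination
  by (relation "measure id") (auto elim!: oddE)

function twisted_stern :: "nat \<Rightarrow> int" where
  "twisted_stern n =
     (if n = 0 then 0
      else if n = 1 then 1
      else if even n then - twisted_stern (n div 2)
      else - twisted_stern (n div 2) - twisted_stern (n div 2 + 1))"
  by pat_completeness auto
termination
  by (relation "measure id") (auto elim!: oddE)

declare stern.simps [simp del] twisted_stern.simps [simp del]

lemma stern_rec:
  "stern 0 = 0"
  "stern 1 = 1"
  "n \<ge> 1 \<Longrightarrow> stern (2 * n) = stern n"
  "n \<ge> 1 \<Longrightarrow> stern (2 * n + 1) = stern n + stern (n + 1)"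
  by (subst stern.simps, simp)+

text \<open>The restriction \<open>n \<ge> 1\<close> matters here: the odd rule at \<open>n = 0\<close> would
  contradict the initial value at \<open>1\<close>.\<close>

lemma twisted_stern_rec:
  "twisted_stern 0 = 0"
  "twisted_stern 1 = 1"
  "n \<ge> 1 \<Longrightarrow> twisted_stern (2 * n) = - twisted_stern n"
  "n \<ge> 1 \<Longrightarrow> twisted_stern (2 * n + 1) = - twisted_stern n - twisted_stern (n + 1)"
  by (subst twisted_stern.simps, simp)+

end

(* Every identity follows by induction on e: both sides obey the same recurrence when the argument
   is halved. *)
theory Submission
  imports Defs
begin

text \<open>Along a dyadic block, the values at level e+1 come from those at level e: an even offset
  copies one value, an odd offset adds two neighbours, and for t every step also flips the sign,
  whence \<open>(- 1) ^ e\<close>. Both sides of each identity refine in this way, reversed blocks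
  included because the rule is symmetric in the two neighbours. Only the values at e = 0 must match:
  s(1), s(2) = 1, 1 and t(1), t(2) = 1, -1 for \<open>stern_twisted_stern_power_add\<close>; t(3),
  t(4), t(5) and, read backwards, t(6), t(5), t(4), both equal to s(0), s(1), s(2) = 0, 1, 1, for
  the two halves of (ii).\<close>

lemma stern_double: "stern (2 * n) = stern n"
  using stern_rec by (cases "n = 0") auto

lemma stern_double_Suc: "stern (Suc (2 * n)) = stern n + stern (Suc n)"
  using stern_rec(1,2) stern_rec(4)[of n] by (cases "n = 0") auto

lemma twisted_stern_double: "twisted_stern (2 * n) = - twisted_stern n"
  using twisted_stern_rec by (cases "n = 0") auto

text \<open>For s the odd rule survives at 0, as s(1) = s(0) + s(1); for t it would give t(1) =
  -t(1), so positivity has to be checked at each use.\<close>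

lemma twisted_stern_double_Suc:
  "n \<ge> 1 \<Longrightarrow> twisted_stern (Suc (2 * n)) = - twisted_stern n - twisted_stern (Suc n)"
  using twisted_stern_rec(4)[of n] by simp

lemma stern_2: "stern 2 = 1"
  using stern_double[of 1] stern_rec(2) by simp

lemma twisted_stern_small:
  "twisted_stern 2 = - 1" "twisted_stern 3 = 0" "twisted_stern 4 = 1"
  "twisted_stern 5 = 1" "twisted_stern 6 = 0"
proof -
  show t2: "twisted_stern 2 = - 1"
    using twisted_stern_double[of 1] twisted_stern_rec(2) by simp
  show t3: "twisted_stern 3 = 0"
    using twisted_stern_rec(4)[of 1] twisted_stern_rec(2) t2 by (simp add: numeral_eq_Suc)
  show "twisted_stern 4 = 1"
    using twisted_stern_double[of 2] t2 by simp
  show "twisted_stern 5 = 1"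
    using twisted_stern_rec(4)[of 2] t2 t3 by simp
  show "twisted_stern 6 = 0"
    using twisted_stern_double[of 3] t3 by simp
qed

(* The sum hypothesis replaces the truncated difference k = 2 ^ e - n. *)
lemma stern_twisted_stern_power_add:
  assumes "n + k = 2 ^ e"
  shows "stern (2 ^ e + n) = stern k + stern n"
    and "twisted_stern (2 ^ e + n) = (- 1) ^ e * (stern k - stern n)"
proof -
  have "stern (2 ^ e + n) = stern k + stern n \<and>
      twisted_stern (2 ^ e + n) = (- 1) ^ e * (stern k - stern n)"
    using assms
  proof (induction e arbitrary: n k)
    case 0
    then have "n = 0 \<and> k = 1 \<or> n = 1 \<and> k = 0" by auto
    then show ?case
      using stern_rec(1,2) stern_2 twisted_stern_rec(2) twisted_stern_small(1)
      by (auto simp: numeral_2_eq_2)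
  next
    case (Suc e)
    show ?case
    proof (cases "even n")
      case True
      then obtain m where m: "n = 2 * m" by (elim evenE)
      from True Suc.prems have "even k" by (metis even_add even_power even_numeral zero_less_Suc)
      then obtain l where l: "k = 2 * l" by (elim evenE)
      have arg: "2 ^ Suc e + n = 2 * (2 ^ e + m)" by (simp add: m)
      have "m + l = 2 ^ e" using Suc.prems m l by simp
      from Suc.IH[OF this] show ?thesis
        unfolding arg unfolding m l stern_double twisted_stern_double
        by (simp add: algebra_simps)
    next
      case False
      then obtain m where m: "n = Suc (2 * m)" by (auto elim: oddE)
      from False Suc.prems have "odd k" by (metis even_add even_power even_numeral zero_less_Suc)
      then obtain l where l: "k = Suc (2 * l)" by (auto elim: oddE)
      have arg: "2 ^ Suc e + n = Suc (2 * (2 ^ e + m))" by (simp add: m)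
      have pos: "1 \<le> 2 ^ e + m" by (simp add: Suc_le_eq)
      \<comment> \<open>The neighbours pair crosswise: \<open>m\<close> with \<open>Suc l\<close>
        and \<open>Suc m\<close> with \<open>l\<close>. Adding the two induction hypotheses rebuilds
        the odd rule for both \<open>n\<close> and \<open>k\<close>.\<close>
      have "m + Suc l = 2 ^ e" "Suc m + l = 2 ^ e" using Suc.prems m l by simp_all
      from this[THEN Suc.IH] show ?thesis
        unfolding arg unfolding m l stern_double_Suc twisted_stern_double_Suc[OF pos]
        by (simp add: algebra_simps)
    qed
  qed
  then show "stern (2 ^ e + n) = stern k + stern n"
    and "twisted_stern (2 ^ e + n) = (- 1) ^ e * (stern k - stern n)" by auto
qed

text \<open>The bound reflects the base block: t(3), t(4), t(5) agree with s(0), s(1), s(2), but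
  t(6) = 0 while s(3) = 2.\<close>

lemma twisted_stern_3_power_add:
  "n \<le> 2 * 2 ^ e \<Longrightarrow> twisted_stern (3 * 2 ^ e + n) = (- 1) ^ e * stern n"
proof (induction e arbitrary: n)
  case 0
  then have "n = 0 \<or> n = 1 \<or> n = 2" by auto
  then show ?case
    using stern_rec(1,2) stern_2 twisted_stern_small by auto
next
  case (Suc e)
  show ?case
  proof (cases "even n")
    case True
    then obtain m where m: "n = 2 * m" by (elim evenE)
    have arg: "3 * 2 ^ Suc e + n = 2 * (3 * 2 ^ e + m)" by (simp add: m)
    have "m \<le> 2 * 2 ^ e" using Suc.prems m by simp
    from Suc.IH[OF this] show ?thesis
      unfolding arg unfolding m stern_double twisted_stern_double by simp
  next
    case False
    then obtain m where m: "n = Suc (2 * m)" by (auto elim: oddE)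
    have arg: "3 * 2 ^ Suc e + n = Suc (2 * (3 * 2 ^ e + m))" by (simp add: m)
    have pos: "1 \<le> 3 * 2 ^ e + m" by (simp add: Suc_le_eq)
    \<comment> \<open>The bound on \<open>n\<close> is even, so an odd \<open>n\<close> lies
      strictly below it and the right neighbour \<open>Suc m\<close> is still in range.\<close>
    have "m \<le> 2 * 2 ^ e" "Suc m \<le> 2 * 2 ^ e" using Suc.prems m by simp_all
    from this[THEN Suc.IH] show ?thesis
      unfolding arg unfolding m stern_double_Suc twisted_stern_double_Suc[OF pos]
      by (simp add: algebra_simps)
  qed
qed

text \<open>Here \<open>m\<close> is the reflected argument; writing it through a sum keeps
  truncated subtraction out of the induction.\<close>

lemma twisted_stern_6_power_diff:
  assumes "m + n = 6 * 2 ^ e" "n \<le> 2 * 2 ^ e"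
  shows "twisted_stern m = (- 1) ^ e * stern n"
  using assms
proof (induction e arbitrary: m n)
  case 0
  then have "n = 0 \<and> m = 6 \<or> n = 1 \<and> m = 5 \<or> n = 2 \<and> m = 4" by auto
  then show ?case
    using stern_rec(1,2) stern_2 twisted_stern_small by auto
next
  case (Suc e)
  show ?case
  proof (cases "even n")
    case True
    then obtain l where l: "n = 2 * l" by (elim evenE)
    from True Suc.prems have "even m" by (metis even_add even_mult_iff even_numeral)
    then obtain j where j: "m = 2 * j" by (elim evenE)
    have "j + l = 6 * 2 ^ e" "l \<le> 2 * 2 ^ e" using Suc.prems l j by simp_all
    from Suc.IH[OF this] show ?thesis
      unfolding l j stern_double twisted_stern_double by simp
  next
    case False
    then obtain l where l: "n = Suc (2 * l)" by (auto elim: oddE)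
    from False Suc.prems have "odd m" by (metis even_add even_mult_iff even_numeral)
    then obtain j where j: "m = Suc (2 * j)" by (auto elim: oddE)
    \<comment> \<open>Since \<open>j + l + 1 = 6 * 2 ^ e\<close>, reflection exchanges left and
      right neighbours.\<close>
    have IH: "twisted_stern j = (- 1) ^ e * stern (Suc l)"
      "twisted_stern (Suc j) = (- 1) ^ e * stern l"
      using Suc.prems l j by (auto intro!: Suc.IH)
    have pos: "1 \<le> j" using Suc.prems l j by simp
    show ?thesis
      unfolding l j stern_double_Suc twisted_stern_double_Suc[OF pos] IH
      by (simp add: algebra_simps)
  qed
qed

theorem mainTheorem2:
  "(\<forall>(e::nat) (n::nat). n \<le> 2 ^ e \<longrightarrow>
      stern (2 ^ e + n) = stern (2 ^ e - n) + stern n \<and>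
      twisted_stern (2 ^ e + n) = (- 1) ^ e * (stern (2 ^ e - n) - stern n)) \<and>
   (\<forall>(e::nat) (n::nat). n \<le> 2 ^ (e + 1) \<longrightarrow>
      twisted_stern (3 * 2 ^ e + n) = twisted_stern (6 * 2 ^ e - n) \<and>
      twisted_stern (6 * 2 ^ e - n) = (- 1) ^ e * stern n)"
proof (intro conjI allI impI)
  fix e n :: nat
  assume "n \<le> 2 ^ e"
  then have "n + (2 ^ e - n) = 2 ^ e" by simp
  then show "stern (2 ^ e + n) = stern (2 ^ e - n) + stern n"
    and "twisted_stern (2 ^ e + n) = (- 1) ^ e * (stern (2 ^ e - n) - stern n)"
    by (rule stern_twisted_stern_power_add)+
next
  fix e n :: nat
  assume "n \<le> 2 ^ (e + 1)"
  then have n: "n \<le> 2 * 2 ^ e" by simp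
  then have "6 * 2 ^ e - n + n = 6 * 2 ^ e" by simp
  from twisted_stern_6_power_diff[OF this n]
  show diff: "twisted_stern (6 * 2 ^ e - n) = (- 1) ^ e * stern n" .
  show "twisted_stern (3 * 2 ^ e + n) = twisted_stern (6 * 2 ^ e - n)"
    by (simp add: diff twisted_stern_3_power_add[OF n])
qed

end
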